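(* Let $0<q<1$. For all $n\in\mathbb{Z}_{+}=\{0,1,2,\dots\}$ and all $x\in\mathbb{C}$, one has $$\varphi_{n}(x;q^{-1})=\frac{1}{2}q^{-(n-1)^{2}/4}\left(\mathcal{E}_{q}(x)\,\mathcal{E}_{q}(-q^{n/2}x)-(-1)^{n}\,\mathcal{E}_{q}(-x)\,\mathcal{E}_{q}(q^{n/2}x)\right).$$
   Context: Here $0<q<1$ and fractional powers of $q$ are positive reals. $(a;q)_{n}=\prod_{k=0}^{n-1}(1-aq^{k})$. The $q^{-1}$-Fibonacci polynomials $\varphi_n(x;q^{-1})$, $n\in\mathbb{Z}_+$, are defined by $$\varphi_{n}(x;q^{-1})=\sum_{k\ge 0,\ 2k<n}\frac{(q;q)_{n-k-1}}{(q;q)_{k}(q;q)_{n-2k-1}}\,q^{k(k+1-n)}x^{n-2k-1};$$ equivalently $\varphi_0=0$, $\varphi_1=1$ and $\varphi_{n+1}(x;q^{-1})=x\varphi_{n}(x;q^{-1})+q^{-(n-1)}\varphi_{n-1}(x;q^{-1})$ for $n\ge1$. The $q$-exponential function is the entire function $\mathcal{E}_{q}(z)=\sum_{n=0}^{\infty}\frac{q^{n^{2}/4}}{(q;q)_{n}}z^{n}$. *)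

theory Defs
  imports Complex_Main
begin

definition qpoch :: "real \<Rightarrow> real \<Rightarrow> nat \<Rightarrow> real" where
  "qpoch a q n = (\<Prod>k<n. 1 - a * q ^ k)"

text \<open>The natural-number subtractions below are exact because \<open>2 * k < n\<close>; the exponent of
  \<open>q\<close> may be negative and is therefore an integer power.\<close>

definition qinv_fib :: "real \<Rightarrow> nat \<Rightarrow> complex \<Rightarrow> complex" where
  "qinv_fib q n x =
     (\<Sum>k | 2 * k < n.
        of_real (qpoch q q (n - k - 1) / (qpoch q q k * qpoch q q (n - 2 * k - 1))
                 * q powi (int k * (int k + 1 - int n)))
        * x ^ (n - 2 * k - 1))"

definition qexp :: "real \<Rightarrow> complex \<Rightarrow> complex" where
  "qexp q z = (\<Sum>n. of_real (q powr (real n ^ 2 / 4) / qpoch q q n) * z ^ n)"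

end

theory Submission
  imports Defs
begin

text \<open>Write \<open>E\<close> for the \<open>q\<close>-exponential function. Both sides of the identity solve the
  three-term recurrence \<open>f (n + 2) = x f (n + 1) + q powi (- n) f n\<close> with \<open>f 0 = 0\<close> and
  \<open>f 1 = 1\<close>, hence they agree.

  For the polynomials, comparing coefficients turns the recurrence into the \<open>q\<close>-Pascal rule
  (\<open>q_pascal\<close>, \<open>qinv_fib_rec\<close>).

  For the other side, everything comes from the functional equation
  \<open>E z = E (q z) + q powr (1/4) z E (q powr (1/2) z)\<close> (\<open>qexp_shift\<close>). Substituting
  \<open>z = - q powr (n/2) x\<close> or \<open>z = q powr (n/2) x\<close>, it says that \<open>E (- q powr (n/2) x)\<close> and
  \<open>(-1)^n E (q powr (n/2) x)\<close>, as sequences in \<open>n\<close>, both solve the recurrence once they are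
  multiplied by \<open>q powr (- (n - 1)\<^sup>2/4)\<close>. The linear combination in the theorem has
  up to a common factor the coefficients \<open>E x\<close> and \<open>- E (- x)\<close>, which do not depend on \<open>n\<close>; they are chosen so that the value at
  \<open>n = 0\<close> vanishes. The value at \<open>n = 1\<close> is, up to a constant, a Casorati determinant of the two
  solutions: the functional equation makes it invariant under \<open>x \<mapsto> q powr (1/2) x\<close>, so by
  continuity it equals its value at \<open>x = 0\<close> (\<open>qexp_casoratian\<close>).\<close>

section \<open>The recurrence for the polynomials\<close>

text \<open>Extending the summand by zero lets sums for different \<open>n\<close> share one index range, so that
  the recurrence can be checked term by term.\<close>

definition qinv_fib_term :: "real \<Rightarrow> nat \<Rightarrow> complex \<Rightarrow> nat \<Rightarrow> complex" where
  "qinv_fib_term q n x k =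
     (if 2 * k < n then
        of_real (qpoch q q (n - k - 1) / (qpoch q q k * qpoch q q (n - 2 * k - 1))
                 * q powi (int k * (int k + 1 - int n)))
        * x ^ (n - 2 * k - 1) else 0)"

lemma qinv_fib_eq_sum_term:
  assumes "n \<le> Suc m"
  shows "qinv_fib q n x = (\<Sum>k\<le>m. qinv_fib_term q n x k)"
proof -
  have "(\<Sum>k\<le>m. qinv_fib_term q n x k) = (\<Sum>k | 2 * k < n. qinv_fib_term q n x k)"
    using assms by (intro sum.mono_neutral_right) (auto simp: qinv_fib_term_def)
  then show ?thesis
    by (simp add: qinv_fib_def qinv_fib_term_def)
qed

lemma qpoch_0 [simp]: "qpoch a q 0 = 1"
  by (simp add: qpoch_def)

lemma qpoch_Suc: "qpoch q q (Suc n) = qpoch q q n * (1 - q ^ Suc n)"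
  by (simp add: qpoch_def)

lemma qpoch_pos:
  assumes "0 < q" "q < 1"
  shows "qpoch q q n > 0"
  using assms by (induction n) (auto simp: qpoch_Suc power_Suc_less_one simp del: power_Suc)

text \<open>This is the \<open>q\<close>-Pascal rule for the Gaussian binomial coefficient of \<open>k + i + 2\<close> over
  \<open>k + 1\<close>. Over the common denominator it reduces to
  \<open>1 - q^(k+i+2) = q^(k+1) (1 - q^(i+1)) + (1 - q^(k+1))\<close>.\<close>

lemma q_pascal:
  assumes "0 < q" "q < 1"
  shows "qpoch q q (Suc (Suc (k + i))) / (qpoch q q (Suc k) * qpoch q q (Suc i)) =
    q ^ Suc k * (qpoch q q (Suc (k + i)) / (qpoch q q (Suc k) * qpoch q q i)) +
    qpoch q q (Suc (k + i)) / (qpoch q q k * qpoch q q (Suc i))"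
proof -
  have nz: "qpoch q q j \<noteq> 0" "1 - q ^ Suc j \<noteq> 0" for j
    using qpoch_pos[OF assms, of j] power_Suc_less_one[OF assms, of j] by auto
  have split: "1 - q ^ Suc (Suc (k + i)) = q ^ Suc k * (1 - q ^ Suc i) + (1 - q ^ Suc k)"
    by (simp add: algebra_simps power_add)
  show ?thesis
    unfolding qpoch_Suc[of q "Suc (k + i)"] qpoch_Suc[of q k] qpoch_Suc[of q i] split
    using nz by (simp add: divide_simps del: power_Suc) (simp add: algebra_simps)
qed

text \<open>Lowering \<open>k\<close> by one while lowering \<open>n\<close> by two preserves the power of \<open>x\<close>; this is why
  the term of index \<open>k + 1\<close> for \<open>n + 2\<close> is matched with index \<open>k + 1\<close> for \<open>n + 1\<close>, where the
  factor \<open>x\<close> supplies the missing power, and with index \<open>k\<close> for \<open>n\<close>.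
  The cases are those where no term, all but the middle one, or all three terms are present.\<close>

lemma qinv_fib_term_Suc_Suc:
  assumes "0 < q" "q < 1"
  shows "qinv_fib_term q (Suc (Suc n)) x (Suc k) =
    x * qinv_fib_term q (Suc n) x (Suc k) + of_real (q powi - int n) * qinv_fib_term q n x k"
proof -
  consider "n \<le> 2 * k" | "n = 2 * k + 1" | i where "n = 2 * k + 2 + i"
    by (metis Suc_eq_plus1 Suc_leI add_2_eq_Suc' le_Suc_eq le_iff_add not_le)
  then show ?thesis
  proof cases
    case 1
    then show ?thesis by (simp add: qinv_fib_term_def)
  next
    case 2
    have nz: "qpoch q q j \<noteq> 0" for j
      using qpoch_pos[OF assms, of j] by simp
    have "q powi (int (Suc k) * (int (Suc k) + 1 - int (Suc (Suc n)))) =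
        q powi - int n * q powi (int k * (int k + 1 - int n))"
      using assms 2 by (simp flip: power_int_add) (simp add: algebra_simps)
    with 2 show ?thesis
      by (simp add: qinv_fib_term_def nz)
  next
    case 3
    \<comment> \<open>The power of \<open>q\<close> common to all three terms; the middle term keeps the additional factor
      \<open>q^(k+1)\<close> that the \<open>q\<close>-Pascal rule demands.\<close>
    let ?e = "int k * (int k + 1 - int n) - int n"
    let ?A = "qpoch q q (Suc (k + i)) / (qpoch q q (Suc k) * qpoch q q i)"
    let ?B = "qpoch q q (Suc (k + i)) / (qpoch q q k * qpoch q q (Suc i))"
    have e1: "int (Suc k) * (int (Suc k) + 1 - int (Suc (Suc n))) = ?e"
      by (simp add: algebra_simps)
    have e2: "int (Suc k) * (int (Suc k) + 1 - int (Suc n)) = int (Suc k) + ?e"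
      by (simp add: algebra_simps)
    have p2: "q powi (int (Suc k) + ?e) = q ^ Suc k * q powi ?e"
      using assms by (subst power_int_add) (auto simp del: power_Suc of_nat_Suc)
    have p3: "q powi ?e = q powi - int n * q powi (int k * (int k + 1 - int n))"
      using assms by (simp flip: power_int_add)
    have t1: "qinv_fib_term q (Suc (Suc n)) x (Suc k) =
        of_real ((q ^ Suc k * ?A + ?B) * q powi ?e) * x ^ Suc i"
      unfolding qinv_fib_term_def e1 using 3 q_pascal[OF assms, of k i] by simp
    have t2: "qinv_fib_term q (Suc n) x (Suc k) = of_real (?A * (q ^ Suc k * q powi ?e)) * x ^ i"
      unfolding qinv_fib_term_def e2 p2 using 3 by simp
    have t3: "qinv_fib_term q n x k =
        of_real (?B * q powi (int k * (int k + 1 - int n))) * x ^ Suc i"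
      unfolding qinv_fib_term_def using 3 by simp
    show ?thesis
      unfolding t1 t2 t3 p3 by (simp only: of_real_mult of_real_add power_Suc) (simp only: algebra_simps)
  qed
qed

lemma qinv_fib_rec:
  assumes "0 < q" "q < 1"
  shows "qinv_fib q (Suc (Suc n)) x =
    x * qinv_fib q (Suc n) x + of_real (q powi - int n) * qinv_fib q n x"
proof -
  have t0: "qinv_fib_term q (Suc (Suc n)) x 0 = x * qinv_fib_term q (Suc n) x 0"
    using qpoch_pos[OF assms, of n] qpoch_pos[OF assms, of "Suc n"]
    by (simp add: qinv_fib_term_def)
  have "qinv_fib q (Suc (Suc n)) x = qinv_fib_term q (Suc (Suc n)) x 0 +
      (\<Sum>k\<le>n. qinv_fib_term q (Suc (Suc n)) x (Suc k))"
    by (subst qinv_fib_eq_sum_term[of _ "Suc n"]) (simp_all only: order.refl sum.atMost_Suc_shift)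
  also have "\<dots> = x * (qinv_fib_term q (Suc n) x 0 + (\<Sum>k\<le>n. qinv_fib_term q (Suc n) x (Suc k)))
      + of_real (q powi - int n) * (\<Sum>k\<le>n. qinv_fib_term q n x k)"
    unfolding t0 qinv_fib_term_Suc_Suc[OF assms]
    by (simp only: sum.distrib sum_distrib_left distrib_left add.assoc)
  also have "qinv_fib_term q (Suc n) x 0 + (\<Sum>k\<le>n. qinv_fib_term q (Suc n) x (Suc k))
      = qinv_fib q (Suc n) x"
    by (subst qinv_fib_eq_sum_term[of _ "Suc n"]) (simp, simp only: sum.atMost_Suc_shift)
  also have "(\<Sum>k\<le>n. qinv_fib_term q n x k) = qinv_fib q n x"
    by (subst qinv_fib_eq_sum_term[of _ n]) simp_all
  finally show ?thesis .
qed

section \<open>The q-exponential function\<close>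

definition qexp_coeff :: "real \<Rightarrow> nat \<Rightarrow> complex" where
  "qexp_coeff q n = of_real (q powr (real n ^ 2 / 4) / qpoch q q n)"

lemma qexp_eq: "qexp q z = (\<Sum>n. qexp_coeff q n * z ^ n)"
  by (simp add: qexp_def qexp_coeff_def)

text \<open>The functional equation of the \<open>q\<close>-exponential, read off at the power \<open>z^(n+1)\<close>. It holds because
  \<open>(n + 1)\<^sup>2/4 = n\<^sup>2/4 + n/2 + 1/4\<close>. The same ratio of consecutive coefficients
  gives convergence.\<close>

lemma qexp_coeff_Suc:
  assumes "0 < q" "q < 1"
  shows "(1 - of_real q ^ Suc n) * qexp_coeff q (Suc n) =
    of_real (q powr (1/4)) * of_real (q powr (1/2)) ^ n * qexp_coeff q n"
proof -
  have "q powr (real (Suc n) ^ 2 / 4) =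
      q powr (1/4 + 1/2 * real n + real n ^ 2 / 4)"
    by (simp add: power2_eq_square field_simps)
  also have "\<dots> = q powr (1/4) * (q powr (1/2)) ^ n * q powr (real n ^ 2 / 4)"
    using assms by (simp add: powr_add powr_powr flip: powr_realpow)
  finally have "(1 - q ^ Suc n) * (q powr (real (Suc n) ^ 2 / 4) / qpoch q q (Suc n)) =
      q powr (1/4) * (q powr (1/2)) ^ n * (q powr (real n ^ 2 / 4) / qpoch q q n)"
    using power_Suc_less_one[OF assms, of n]
    by (simp add: qpoch_Suc del: power_Suc of_nat_Suc)
  from this[THEN arg_cong[where f = "of_real :: real \<Rightarrow> complex"]] show ?thesis
    by (simp add: qexp_coeff_def)
qed

text \<open>The ratio of consecutive terms is at most a constant times \<open>q powr (n/2)\<close>, which tends to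
  zero, so the series converges in the whole plane.\<close>

lemma summable_qexp:
  assumes "0 < q" "q < 1"
  shows "summable (\<lambda>n. qexp_coeff q n * z ^ n)"
proof -
  define s where "s = q powr (1/2)"
  define b where "b = q powr (1/4) * cmod z / (1 - q)"
  have s: "0 < s" "s < 1"
    using assms by (auto simp: s_def powr01_less_one)
  have "(\<lambda>n. b * s ^ n) \<longlonglongrightarrow> b * 0"
    using s by (intro tendsto_mult tendsto_const LIMSEQ_power_zero) simp
  then have "\<forall>\<^sub>F n in sequentially. b * s ^ n < 1 / 2"
    by (rule order_tendstoD) simp
  then obtain N where N: "b * s ^ n < 1 / 2" if "n \<ge> N" for n
    by (auto simp: eventually_sequentially)
  have step: "cmod (qexp_coeff q (Suc n) * z ^ Suc n) \<le> b * s ^ n * cmod (qexp_coeff q n * z ^ n)" for n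
  proof -
    have q1: "1 - q \<le> 1 - q ^ Suc n"
      using assms power_decreasing[of 1 "Suc n" q] by simp
    have "(1 - q ^ Suc n) * cmod (qexp_coeff q (Suc n)) =
        cmod ((1 - of_real q ^ Suc n) * qexp_coeff q (Suc n))"
    proof -
      have "cmod (1 - of_real q ^ Suc n) = cmod (of_real (1 - q ^ Suc n))" by simp
      also have "\<dots> = 1 - q ^ Suc n"
        unfolding norm_of_real using q1 assms by linarith
      finally show ?thesis by (simp only: norm_mult)
    qed
    also have "\<dots> = q powr (1/4) * s ^ n * cmod (qexp_coeff q n)"
      unfolding qexp_coeff_Suc[OF assms] using s by (simp add: norm_mult norm_power s_def)
    finally have "(1 - q) * cmod (qexp_coeff q (Suc n)) \<le> q powr (1/4) * s ^ n * cmod (qexp_coeff q n)"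
      using mult_right_mono[OF q1, of "cmod (qexp_coeff q (Suc n))"] by simp
    then have "cmod (qexp_coeff q (Suc n)) \<le> q powr (1/4) / (1 - q) * s ^ n * cmod (qexp_coeff q n)"
      using assms by (simp add: field_simps)
    from mult_right_mono[OF this, of "cmod z ^ Suc n"] show ?thesis
      by (simp add: b_def norm_mult norm_power mult_ac)
  qed
  show ?thesis
  proof (rule summable_ratio_test[of "1/2" N])
    fix n assume "n \<ge> N"
    then have "b * s ^ n * cmod (qexp_coeff q n * z ^ n) \<le> 1 / 2 * cmod (qexp_coeff q n * z ^ n)"
      using N[of n] by (intro mult_right_mono) auto
    with step[of n] show "cmod (qexp_coeff q (Suc n) * z ^ Suc n) \<le> 1 / 2 * cmod (qexp_coeff q n * z ^ n)"
      by linarith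
  qed simp
qed

lemma qexp_0:
  assumes "0 < q"
  shows "qexp q 0 = 1"
  using assms unfolding qexp_eq powser_zero by (simp add: qexp_coeff_def)

lemma isCont_qexp:
  assumes "0 < q" "q < 1"
  shows "isCont (qexp q) z"
  unfolding qexp_eq[abs_def]
  by (rule isCont_powser[of _ "of_real (cmod z + 1)"]) (use summable_qexp[OF assms] in auto)

text \<open>In \<open>qexp q z - qexp q (q z)\<close> each coefficient gains the factor \<open>1 - q^n\<close>, which cancels the
  last factor of the \<open>q\<close>-Pochhammer symbol; the constant term drops out, and shifting the index
  restores the series at \<open>q powr (1/2) z\<close>.\<close>

lemma qexp_shift:
  assumes "0 < q" "q < 1"
  shows "qexp q z = qexp q (of_real q * z) +
    of_real (q powr (1/4)) * z * qexp q (of_real (q powr (1/2)) * z)"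
proof -
  note sm = summable_qexp[OF assms]
  let ?d = "\<lambda>n. qexp_coeff q n * z ^ n - qexp_coeff q n * (of_real q * z) ^ n"
  have sd: "summable ?d"
    by (intro summable_diff sm)
  have dSuc: "?d (Suc n) = of_real (q powr (1/4)) * z *
      (qexp_coeff q n * (of_real (q powr (1/2)) * z) ^ n)" for n
  proof -
    have "?d (Suc n) = (1 - of_real q ^ Suc n) * qexp_coeff q (Suc n) * z ^ Suc n"
      unfolding power_mult_distrib by (simp add: algebra_simps del: power_Suc)
    then show ?thesis
      unfolding qexp_coeff_Suc[OF assms] by (simp add: power_mult_distrib mult_ac)
  qed
  have "qexp q z - qexp q (of_real q * z) = (\<Sum>n. ?d n)"
    unfolding qexp_eq by (intro suminf_diff sm)
  also have "\<dots> = (\<Sum>n. ?d (Suc n))"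
    using suminf_split_head[OF sd] by simp
  also have "\<dots> = of_real (q powr (1/4)) * z * qexp q (of_real (q powr (1/2)) * z)"
    unfolding dSuc qexp_eq by (intro suminf_mult sm)
  finally show ?thesis by (simp add: algebra_simps)
qed

text \<open>The left-hand side \<open>W x\<close> is unchanged under \<open>x \<mapsto> q powr (1/2) x\<close>: expanding \<open>qexp q x\<close> and
  \<open>qexp q (- x)\<close> by the functional equation produces two extra products that differ only in sign. Iterating,
  the argument tends to \<open>0\<close>, where \<open>W\<close> takes the value \<open>2\<close>.\<close>

lemma qexp_casoratian:
  assumes "0 < q" "q < 1"
  shows "qexp q x * qexp q (- of_real (q powr (1/2)) * x) +
    qexp q (- x) * qexp q (of_real (q powr (1/2)) * x) = 2"
proof -
  define s where "s = complex_of_real (q powr (1/2))"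
  define W where "W = (\<lambda>x. qexp q x * qexp q (- s * x) + qexp q (- x) * qexp q (s * x))"
  have ss: "complex_of_real q = s * s"
    unfolding s_def using assms by (simp flip: of_real_mult powr_add)
  have inv: "W x = W (s * x)" for x
  proof -
    define c where "c = complex_of_real (q powr (1/4))"
    have fwd: "qexp q x = qexp q (s * (s * x)) + c * x * qexp q (s * x)"
      and bwd: "qexp q (- x) = qexp q (- (s * (s * x))) - c * x * qexp q (- (s * x))"
      using qexp_shift[OF assms, of x] qexp_shift[OF assms, of "- x"]
      by (simp_all add: ss c_def mult.assoc flip: s_def)
    show ?thesis
      by (simp add: W_def fwd bwd distrib_right left_diff_distrib)
  qed
  have iter: "W (s ^ m * x) = W x" for m
    by (induction m) (simp_all add: mult.assoc flip: inv)
  have "isCont W 0"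
    unfolding W_def
    by (intro continuous_intros isCont_o2[OF _ isCont_qexp[OF assms]] isCont_qexp[OF assms])
  moreover have "(\<lambda>m. s ^ m * x) \<longlonglongrightarrow> 0 * x"
    using assms by (intro tendsto_mult tendsto_const LIMSEQ_power_zero)
      (auto simp: s_def powr01_less_one)
  ultimately have "(\<lambda>m. W (s ^ m * x)) \<longlonglongrightarrow> W 0"
    using isCont_tendsto_compose[of 0 W "\<lambda>m. s ^ m * x" sequentially] by simp
  then have "W x = W 0"
    unfolding iter by (simp add: LIMSEQ_const_iff)
  then show ?thesis
    by (simp add: W_def s_def qexp_0[OF assms(1)])
qed

section \<open>The identity\<close>

definition qexp_side :: "real \<Rightarrow> nat \<Rightarrow> complex \<Rightarrow> complex" where
  "qexp_side q n x = 1 / 2 * of_real (q powr (- ((real n - 1) ^ 2 / 4))) *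
    (qexp q x * qexp q (- of_real (q powr (real n / 2)) * x)
     - (- 1) ^ n * qexp q (- x) * qexp q (of_real (q powr (real n / 2)) * x))"

text \<open>The functional equation, applied at \<open>q powr (n/2) x\<close> and at \<open>- q powr (n/2) x\<close>, links three
  consecutive \<open>n\<close>. The quadratic exponent of the prefactor normalises the coefficients of this relation:
  it turns the coefficient \<open>q powr (1/4 + n/2) x\<close> into \<open>x\<close> and the coefficient \<open>1\<close> into
  \<open>q powi (- n)\<close>.\<close>

lemma qexp_side_rec:
  assumes "0 < q" "q < 1"
  shows "qexp_side q (Suc (Suc n)) x =
    x * qexp_side q (Suc n) x + of_real (q powi - int n) * qexp_side q n x"
proof -
  define h where "h = (\<lambda>n. complex_of_real (q powr (real n / 2)))"
  define w where "w = (\<lambda>n. complex_of_real (q powr (- ((real n - 1) ^ 2 / 4))))"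
  define c where "c = complex_of_real (q powr (1/4))"
  have h1: "of_real (q powr (1/2)) * h n = h (Suc n)"
    unfolding h_def by (simp flip: of_real_mult powr_add add: field_simps)
  have h2: "of_real q * h n = h (Suc (Suc n))"
  proof -
    have "real (Suc (Suc n)) / 2 = 1 + real n / 2"
      by simp
    then have "q powr 1 * q powr (real n / 2) = q powr (real (Suc (Suc n)) / 2)"
      by (simp only: powr_add)
    then show ?thesis
      using assms by (simp add: h_def flip: of_real_mult)
  qed
  have sh: "qexp q (h n * y) = qexp q (h (Suc (Suc n)) * y) + c * h n * y * qexp q (h (Suc n) * y)" for y
    using qexp_shift[OF assms, of "h n * y"] by (simp add: h1[symmetric] h2[symmetric] c_def mult.assoc)
  have w1: "w (Suc (Suc n)) * (c * h n) = w (Suc n)"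
    unfolding w_def c_def h_def
    by (simp flip: of_real_mult powr_add add: field_simps power2_eq_square)
  have w2: "w (Suc (Suc n)) = of_real (q powi - int n) * w n"
  proof -
    have "q powi - int n = q powr (- real n)"
      using powr_real_of_int'[of q "- int n"] assms by simp
    moreover have "- ((real (Suc (Suc n)) - 1) ^ 2 / 4) = - real n + - ((real n - 1) ^ 2 / 4)"
      by (simp add: field_simps power2_eq_square)
    ultimately show ?thesis
      unfolding w_def by (simp only: powr_add of_real_mult)
  qed
  have side: "qexp_side q k x = 1 / 2 * w k *
      (qexp q x * qexp q (h k * - x) - (- 1) ^ k * qexp q (- x) * qexp q (h k * x))" for k
    by (simp add: qexp_side_def w_def h_def)
  let ?P = "qexp q (h (Suc n) * x)" and ?M = "qexp q (h (Suc n) * - x)"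
  have "qexp_side q (Suc (Suc n)) x = 1 / 2 * w (Suc (Suc n)) *
      (qexp q x * (qexp q (h n * - x) + c * h n * x * ?M)
       - (- 1) ^ n * qexp q (- x) * (qexp q (h n * x) - c * h n * x * ?P))"
    by (simp only: side sh[of x] sh[of "- x"]) (simp add: algebra_simps)
  also have "\<dots> = x * (1 / 2 * (w (Suc (Suc n)) * (c * h n)) *
        (qexp q x * ?M + (- 1) ^ n * qexp q (- x) * ?P))
      + 1 / 2 * w (Suc (Suc n)) *
        (qexp q x * qexp q (h n * - x) - (- 1) ^ n * qexp q (- x) * qexp q (h n * x))"
    by (simp add: algebra_simps)
  also have "\<dots> = x * qexp_side q (Suc n) x + of_real (q powi - int n) * qexp_side q n x"
    unfolding w1 unfolding w2 side by (simp add: mult_ac)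
  finally show ?thesis .
qed

theorem proposition3:
  fixes q :: real and n :: nat and x :: complex
  assumes "0 < q" and "q < 1"
  shows "qinv_fib q n x =
    1 / 2 * of_real (q powr (- ((real n - 1) ^ 2 / 4))) *
    (qexp q x * qexp q (- of_real (q powr (real n / 2)) * x)
     - (- 1) ^ n * qexp q (- x) * qexp q (of_real (q powr (real n / 2)) * x))"
proof -
  have "qinv_fib q n x = qexp_side q n x"
  proof (induction n rule: induct_nat_012)
    case 0
    show ?case
      using assms by (simp add: qinv_fib_def qexp_side_def)
  next
    case 1
    have "qinv_fib q 1 x = 1"
      by (subst qinv_fib_eq_sum_term[of _ 0]) (simp_all add: qinv_fib_term_def)
    moreover have "qexp_side q 1 x = 1"
      using qexp_casoratian[OF assms, of x] assms by (simp add: qexp_side_def)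
    ultimately show ?case by simp
  next
    case (ge2 n)
    then show ?case
      by (simp only: qinv_fib_rec[OF assms] qexp_side_rec[OF assms])
  qed
  then show ?thesis
    by (simp only: qexp_side_def)
qed

end
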